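(* Let $X\subseteq\mathbb{R}^n$ be a closed convex set and let $f=(f_1,\dots,f_m):\mathbb{R}\times X\to\mathbb{R}^m$ be such that, for every $T>0$, $t\mapsto f(t,x)$ is integrable on $[0,T]$ for each $x\in X$, and each $x\mapsto f_i(t,x)$ is convex on $X$ for each $t$. Suppose the environment $f$ is viable: there exists $x^\dagger\in X$ with $f(t,x^\dagger)\le 0$ for all $t\ge0$. Let $\delta>0$ and $\bar f_\delta(t,x)=\max\{f(t,x),-\delta\}$ (componentwise). Let $\varepsilon>0$, $x(0)\in X$, $\lambda(0)\in\Lambda=\mathbb{R}^m_+$, and let $(x(t),\lambda(t))\in X\times\Lambda$, $t\ge0$, be a solution of the saddle point controller for the environment $\bar f_\delta$, $$\dot x=\Pi_X\big(x,-\varepsilon \bar f_{\delta,x}(t,x)\lambda\big),\qquad \dot\lambda=\Pi_\Lambda\big(\lambda,\varepsilon \bar f_\delta(t,x)\big).$$ Then the $\delta$-saturated fit $\bar{\mathcal{F}}_T=\int_0^T\bar f_\delta(t,x(t))\,dt$ is bounded for all $T>0$ by a constant independent of $T$; furthermore, for all $T>0$ and $i=1,\dots,m$, $$\bar{\mathcal{F}}_{T,i}\le\min_{x^\dagger\in X^\dagger}\frac1\varepsilon V_{x^\dagger,e_i}(x(0),\lambda(0)),$$ where $X^\dagger=\{x^\dagger\in X: f(t,x^\dagger)\le0 \text{ for all } t\in[0,T]\}$, $e_1,\dots,e_m$ is the canonical basis of $\mathbb{R}^m$, and $V_{\bar x,\bar\lambda}(x,\lambda)=\frac12\big(\|x-\bar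 x\|^2+\|\lambda-\bar\lambda\|^2\big)$.
   Context: Projection: for a closed convex set $Y\subseteq\mathbb{R}^k$, $P_Y(z)=\operatorname{argmin}_{y\in Y}\|y-z\|$ (Euclidean norm), and for $y\in Y$, $v\in\mathbb{R}^k$, $\Pi_Y(y,v)=\lim_{\delta'\to0^+}\big(P_Y(y+\delta' v)-y\big)/\delta'$. Subgradients: for a convex $g:X\to\mathbb{R}$, a subgradient $g_x(x)$ at $x\in X$ is a vector with $g(y)\ge g(x)+g_x(x)^T(y-x)$ for all $y\in X$. Subgradients of the components of $f(t,\cdot)$ and $\bar f_\delta(t,\cdot)$ are assumed to exist at all points of $X$, and $\bar f_{\delta,x}(t,x)\in\mathbb{R}^{n\times m}$ is the matrix whose columns are fixed choices of subgradients of the components of $\bar f_\delta(t,\cdot)$ at $x$. Inequalities between vectors are componentwise; a vector is "bounded" by a constant here in the sense of an upper bound on each component. A solution of the differential equations is a pair of functions absolutely continuous on bounded time intervals satisfying the equations for almost every $t$. The integrals defining the saturated fit along the trajectory are assumed to be well defined. *)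

theory Defs
  imports "HOL-Analysis.Analysis"
begin

text \<open>
  The projection \<open>P_Y\<close> is the library's \<^const>\<open>closest_point\<close>. The limit is written with
  \<^const>\<open>Lim\<close>, which is a meaningless default where the limit does not exist; for closed convex
  \<open>Y\<close> and \<open>y \<in> Y\<close> it always exists.
\<close>

definition proj_dir :: "'a::euclidean_space set \<Rightarrow> 'a \<Rightarrow> 'a \<Rightarrow> 'a" where
  "proj_dir Y y v = Lim (at_right 0) (\<lambda>d. (closest_point Y (y + d *\<^sub>R v) - y) /\<^sub>R d)"

definition is_subgradient :: "'a::real_inner set \<Rightarrow> ('a \<Rightarrow> real) \<Rightarrow> 'a \<Rightarrow> 'a \<Rightarrow> bool" where
  "is_subgradient X g x s \<longleftrightarrow> (\<forall>y\<in>X. g y \<ge> g x + s \<bullet> (y - x))"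

definition nonneg_orthant :: "(real ^ 'm) set" where
  "nonneg_orthant = {l. 0 \<le> l}"

definition saturated ::
  "real \<Rightarrow> (real \<Rightarrow> real ^ 'n \<Rightarrow> real ^ 'm) \<Rightarrow> real \<Rightarrow> real ^ 'n \<Rightarrow> real ^ 'm" where
  "saturated \<delta> f t x = (\<chi> i. max (f t x $ i) (- \<delta>))"

definition viable :: "(real ^ 'n) set \<Rightarrow> (real \<Rightarrow> real ^ 'n \<Rightarrow> real ^ 'm) \<Rightarrow> bool" where
  "viable X f \<longleftrightarrow> (\<exists>xd\<in>X. \<forall>t\<ge>0. f t xd \<le> 0)"

text \<open>
  The library has absolute continuity for measures only. A finite family of non-overlapping
  subintervals \<open>[a, b]\<close> of \<open>S\<close> is represented by the set of its endpoint pairs \<open>(a, b)\<close>.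
\<close>

definition abs_continuous_on :: "real set \<Rightarrow> (real \<Rightarrow> 'a::real_normed_vector) \<Rightarrow> bool" where
  "abs_continuous_on S f \<longleftrightarrow>
     (\<forall>e>0. \<exists>d>0. \<forall>I :: (real \<times> real) set.
        finite I \<longrightarrow>
        (\<forall>(a, b)\<in>I. a \<le> b \<and> {a..b} \<subseteq> S) \<longrightarrow>
        pairwise (\<lambda>(a, b) (a', b'). disjnt {a<..<b} {a'<..<b'}) I \<longrightarrow>
        (\<Sum>(a, b)\<in>I. b - a) < d \<longrightarrow>
        (\<Sum>(a, b)\<in>I. norm (f b - f a)) < e)"

text \<open>
  Solutions live on \<open>t \<ge> 0\<close>; values of \<open>x\<close> and \<open>l\<close> at negative times are irrelevant. The argument
  \<open>G t y\<close> is the \<open>n \<times> m\<close> matrix whose columns are the chosen subgradients of the components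
  of \<open>g t\<close> at \<open>y\<close>.
\<close>

definition saddle_point_solution ::
  "(real ^ 'n) set \<Rightarrow> real \<Rightarrow> (real \<Rightarrow> real ^ 'n \<Rightarrow> real ^ 'm) \<Rightarrow>
   (real \<Rightarrow> real ^ 'n \<Rightarrow> real ^ 'm ^ 'n) \<Rightarrow>
   (real \<Rightarrow> real ^ 'n) \<Rightarrow> (real \<Rightarrow> real ^ 'm) \<Rightarrow> bool" where
  "saddle_point_solution X \<epsilon> g G x l \<longleftrightarrow>
     (\<forall>t\<ge>0. x t \<in> X \<and> l t \<in> nonneg_orthant) \<and>
     (\<forall>T>0. abs_continuous_on {0..T} x \<and> abs_continuous_on {0..T} l) \<and>
     (AE t in lebesgue. t \<ge> 0 \<longrightarrow>
        (x has_vector_derivative proj_dir X (x t) (- (\<epsilon> *\<^sub>R (G t (x t) *v l t)))) (at t within {0..}) \<and>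
        (l has_vector_derivative proj_dir nonneg_orthant (l t) (\<epsilon> *\<^sub>R g t (x t))) (at t within {0..}))"

definition fit ::
  "(real \<Rightarrow> real ^ 'n \<Rightarrow> real ^ 'm) \<Rightarrow> (real \<Rightarrow> real ^ 'n) \<Rightarrow> real \<Rightarrow> real ^ 'm" where
  "fit g x T = (LINT t:{0..T}|lebesgue. g t (x t))"

definition feasible_upto ::
  "(real ^ 'n) set \<Rightarrow> (real \<Rightarrow> real ^ 'n \<Rightarrow> real ^ 'm) \<Rightarrow> real \<Rightarrow> (real ^ 'n) set" where
  "feasible_upto X f T = {xd \<in> X. \<forall>t\<in>{0..T}. f t xd \<le> 0}"

definition energy :: "real ^ 'n \<Rightarrow> real ^ 'm \<Rightarrow> real ^ 'n \<Rightarrow> real ^ 'm \<Rightarrow> real" where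
  "energy xb lb x l = 1 / 2 * ((norm (x - xb))\<^sup>2 + (norm (l - lb))\<^sup>2)"

end

theory Submission
  imports Defs
begin

text \<open>
  Along a solution, \<open>V = energy z (axis i 1)\<close> decreases at rate at least
  \<open>\<epsilon> * saturated \<delta> f t (x t) $ i\<close> for almost every \<open>t\<close>: projecting a velocity onto the tangent
  cone only lowers its inner product with \<open>y - z\<close> for \<open>z\<close> in the set, and the remaining terms are
  controlled by the subgradient inequality at the feasible point \<open>z\<close>. Integrating this bound and
  using \<open>V \<ge> 0\<close> bounds the fit by \<open>V 0 / \<epsilon>\<close>. The feasible set is closed because subgradients make
  the components of \<open>f t\<close> lower semicontinuous on \<open>X\<close>, so the best such bound is attained.
\<close>

section \<open>Projected directions\<close>

text \<open>
  The difference quotient at \<open>d\<close> is the projection of \<open>v\<close> onto \<open>(Y - y) / d\<close>. These sets grow as \<open>d\<close>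
  decreases to 0, so the distance from \<open>v\<close> to its projection decreases, and the obtuse angle
  property of projections turns this into the Cauchy property.
\<close>

lemma proj_dir_inner_le:
  fixes Y :: "'a::euclidean_space set"
  assumes "closed Y" "convex Y" "y \<in> Y" "z \<in> Y"
  shows "(y - z) \<bullet> proj_dir Y y v \<le> (y - z) \<bullet> v"
proof -
  define p where "p d = closest_point Y (y + d *\<^sub>R v)" for d
  define q where "q d = (p d - y) /\<^sub>R d" for d
  have q_eq: "q = (\<lambda>d. (closest_point Y (y + d *\<^sub>R v) - y) /\<^sub>R d)"
    by (simp add: fun_eq_iff q_def p_def)
  have pY: "p d \<in> Y" for d
    unfolding p_def using assms by (intro closest_point_in_set) auto
  have pq: "p d = y + d *\<^sub>R q d" if "d > 0" for d
    using that by (simp add: q_def)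
  \<comment> \<open>The obtuse angle property of the projection point
    \<open>p d = y + d *\<^sub>R q d\<close>, divided by the positive factor
    \<open>d\<close>.\<close>
  have obtuse: "(v - q d) \<bullet> (w - y - d *\<^sub>R q d) \<le> 0" if "d > 0" "w \<in> Y" for d w
  proof -
    have "(y + d *\<^sub>R v - p d) \<bullet> (w - p d) \<le> 0"
      unfolding p_def using assms that by (intro closest_point_dot) auto
    also have "(y + d *\<^sub>R v - p d) \<bullet> (w - p d) = d * ((v - q d) \<bullet> (w - y - d *\<^sub>R q d))"
      unfolding pq[OF \<open>d > 0\<close>] by (simp add: algebra_simps inner_simps)
    finally show ?thesis
      using that by (simp add: mult_le_0_iff)
  qed
  \<comment> \<open>By convexity \<open>y + d' *\<^sub>R q d\<close> lies in \<open>Y\<close>, so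
    \<open>obtuse\<close> at \<open>d'\<close> makes the angle at \<open>q d'\<close> between
    \<open>v\<close> and \<open>q d\<close> non-acute; expanding the square then gives a Pythagorean
    inequality.\<close>
  have mono: "(norm (q d - q d'))\<^sup>2 \<le> (norm (v - q d))\<^sup>2 - (norm (v - q d'))\<^sup>2"
    if "0 < d'" "d' \<le> d" for d d'
  proof -
    have "(1 - d' / d) *\<^sub>R y + (d' / d) *\<^sub>R p d \<in> Y"
      using that assms pY by (intro convexD) (auto simp: field_simps)
    also have "(1 - d' / d) *\<^sub>R y + (d' / d) *\<^sub>R p d = y + d' *\<^sub>R q d"
      using that by (subst pq) (auto simp: algebra_simps)
    finally have "(v - q d') \<bullet> (d' *\<^sub>R (q d - q d')) \<le> 0"
      using obtuse[of d' "y + d' *\<^sub>R q d"] that by (simp add: algebra_simps)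
    then have "(v - q d') \<bullet> (q d - q d') \<le> 0"
      using that by (simp add: mult_le_0_iff)
    moreover have "(norm (v - q d))\<^sup>2
        = (norm (v - q d'))\<^sup>2 + (norm (q d - q d'))\<^sup>2 - 2 * ((v - q d') \<bullet> (q d - q d'))"
      unfolding power2_norm_eq_inner by (simp add: inner_simps inner_commute)
    ultimately show ?thesis by simp
  qed
  \<comment> \<open>Close to their infimum \<open>m\<close> the squared distances from
    \<open>v\<close> vary little, and \<open>mono\<close> bounds the squared distance between two
    quotients by that variation.\<close>
  define m where "m = (INF d\<in>{0<..}. (norm (v - q d))\<^sup>2)"
  have bdd: "bdd_below ((\<lambda>d. (norm (v - q d))\<^sup>2) ` {0<..})"
    by (intro bdd_belowI2[of _ 0]) auto
  have m_le: "m \<le> (norm (v - q d))\<^sup>2" if "d > 0" for d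
    unfolding m_def using bdd that by (intro cINF_lower) auto
  have "cauchy_filter (filtermap q (at_right 0))"
    unfolding cauchy_filter_metric_filtermap
  proof (intro allI impI)
    fix e :: real assume "e > 0"
    have "m < m + (e / 2)\<^sup>2" using \<open>e > 0\<close> by simp
    then have "\<exists>c\<in>{0<..}. (norm (v - q c))\<^sup>2 < m + (e / 2)\<^sup>2"
      unfolding m_def by (subst (asm) cINF_less_iff[OF _ bdd]) auto
    then obtain c where "c > 0" and c: "(norm (v - q c))\<^sup>2 < m + (e / 2)\<^sup>2"
      by auto
    have near: "dist (q c) (q d) < e / 2" if "0 < d" "d \<le> c" for d
    proof -
      have "(norm (q c - q d))\<^sup>2 < (e / 2)\<^sup>2"
        using mono[OF that] m_le[OF that(1)] c by linarith
      then have "norm (q c - q d) < e / 2"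
        by (rule power_less_imp_less_base) (use \<open>e > 0\<close> in simp)
      then show ?thesis by (simp add: dist_norm)
    qed
    have "eventually (\<lambda>d. 0 < d \<and> d \<le> c) (at_right 0)"
      using \<open>c > 0\<close> unfolding eventually_at_right_field by (intro exI[of _ c]) auto
    moreover have "dist (q d) (q d') < e" if "0 < d \<and> d \<le> c" "0 < d' \<and> d' \<le> c" for d d'
      using dist_triangle_half_r[of "q c" "q d" e "q d'"] near that by blast
    ultimately show "\<exists>P. eventually P (at_right 0) \<and> (\<forall>d d'. P d \<and> P d' \<longrightarrow> dist (q d) (q d') < e)"
      by blast
  qed
  moreover have "complete (UNIV :: 'a set)"
    by (metis Cauchy_convergent UNIV_I complete_def convergent_def)
  ultimately obtain L where L: "(q \<longlongrightarrow> L) (at_right 0)"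
    using complete_uniform[where S = UNIV] by (force simp: filterlim_def filtermap_bot_iff)
  \<comment> \<open>Convergence excludes the default value of \<open>Lim\<close>:
    \<open>proj_dir\<close> is a genuine limit here.\<close>
  moreover have "proj_dir Y y v = L"
    unfolding proj_dir_def using L unfolding q_eq by (intro tendsto_Lim) auto
  ultimately have q: "(q \<longlongrightarrow> proj_dir Y y v) (at_right 0)"
    by simp
  \<comment> \<open>\<open>obtuse\<close> with \<open>w = z\<close> passes to the limit;
    \<open>d *\<^sub>R q d\<close> vanishes because \<open>q\<close> converges.\<close>
  have "((\<lambda>d. (v - q d) \<bullet> (z - y - d *\<^sub>R q d)) \<longlongrightarrow>
      (v - proj_dir Y y v) \<bullet> (z - y - 0 *\<^sub>R proj_dir Y y v)) (at_right 0)"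
    by (intro tendsto_intros q)
  moreover have "eventually (\<lambda>d. (v - q d) \<bullet> (z - y - d *\<^sub>R q d) \<le> 0) (at_right 0)"
    using obtuse \<open>z \<in> Y\<close> unfolding eventually_at_right_field by (intro exI[of _ 1]) auto
  ultimately have "(v - proj_dir Y y v) \<bullet> (z - y - 0 *\<^sub>R proj_dir Y y v) \<le> 0"
    by (intro tendsto_upperbound) auto
  then show ?thesis
    by (simp add: inner_simps inner_commute)
qed

section \<open>Absolute continuity on intervals\<close>

definition nonoverlapping_in :: "real set \<Rightarrow> (real \<times> real) set \<Rightarrow> bool" where
  "nonoverlapping_in S I \<longleftrightarrow> finite I \<and> (\<forall>(a, b)\<in>I. a \<le> b \<and> {a..b} \<subseteq> S) \<and>
     pairwise (\<lambda>(a, b) (a', b'). disjnt {a<..<b} {a'<..<b'}) I"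

lemma abs_continuous_on_iff:
  "abs_continuous_on S f \<longleftrightarrow>
     (\<forall>e>0. \<exists>d>0. \<forall>I. nonoverlapping_in S I \<longrightarrow>
        (\<Sum>(a, b)\<in>I. b - a) < d \<longrightarrow> (\<Sum>(a, b)\<in>I. norm (f b - f a)) < e)"
  unfolding abs_continuous_on_def nonoverlapping_in_def by (simp only: imp_conjL)

lemma abs_continuous_onE:
  assumes "abs_continuous_on S f" "e > 0"
  obtains d where "d > 0" and "\<And>I. nonoverlapping_in S I \<Longrightarrow> (\<Sum>(a, b)\<in>I. b - a) < d \<Longrightarrow>
    (\<Sum>(a, b)\<in>I. norm (f b - f a)) < e"
  using assms unfolding abs_continuous_on_iff by meson

lemma abs_continuous_onI:
  assumes "\<And>e. e > 0 \<Longrightarrow> \<exists>d>0. \<forall>I. nonoverlapping_in S I \<longrightarrow>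
    (\<Sum>(a, b)\<in>I. b - a) < d \<longrightarrow> (\<Sum>(a, b)\<in>I. norm (f b - f a)) < e"
  shows "abs_continuous_on S f"
  using assms unfolding abs_continuous_on_iff by blast

text \<open>Increments of \<open>g\<close> are dominated interval by interval, so the modulus of
  \<open>h\<close> for a smaller tolerance serves \<open>g\<close>. This covers both scaling and
  squaring of bounded functions.\<close>

lemma abs_continuous_on_lipschitz_transfer:
  assumes "abs_continuous_on S h" and "L \<ge> 0"
    and lip: "\<And>s t. s \<in> S \<Longrightarrow> t \<in> S \<Longrightarrow> norm (g t - g s) \<le> L * norm (h t - h s)"
  shows "abs_continuous_on S g"
proof (rule abs_continuous_onI)
  fix e :: real assume "e > 0"
  \<comment> \<open>The added 1 keeps the tolerance positive for \<open>L = 0\<close> and makes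
    \<open>L * (e / (L + 1)) < e\<close> strict.\<close>
  then have "e / (L + 1) > 0" using \<open>L \<ge> 0\<close> by simp
  then obtain d where "d > 0" and d: "\<And>I. nonoverlapping_in S I \<Longrightarrow>
      (\<Sum>(s, t)\<in>I. t - s) < d \<Longrightarrow> (\<Sum>(s, t)\<in>I. norm (h t - h s)) < e / (L + 1)"
    using abs_continuous_onE[OF assms(1)] by blast
  have "(\<Sum>(s, t)\<in>I. norm (g t - g s)) < e"
    if I: "nonoverlapping_in S I" "(\<Sum>(s, t)\<in>I. t - s) < d" for I
  proof -
    have "(\<Sum>(s, t)\<in>I. norm (g t - g s)) \<le> (\<Sum>(s, t)\<in>I. L * norm (h t - h s))"
      using I(1) unfolding nonoverlapping_in_def by (intro sum_mono) (force intro!: lip)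
    also have "\<dots> = L * (\<Sum>(s, t)\<in>I. norm (h t - h s))"
      by (simp add: sum_distrib_left case_prod_unfold)
    also have "\<dots> \<le> L * (e / (L + 1))"
      using d[OF I] \<open>L \<ge> 0\<close> by (intro mult_left_mono) auto
    also have "\<dots> < e"
      using \<open>e > 0\<close> \<open>L \<ge> 0\<close> by (simp add: field_simps)
    finally show ?thesis .
  qed
  with \<open>d > 0\<close> show "\<exists>d>0. \<forall>I. nonoverlapping_in S I \<longrightarrow>
      (\<Sum>(s, t)\<in>I. t - s) < d \<longrightarrow> (\<Sum>(s, t)\<in>I. norm (g t - g s)) < e"
    by blast
qed

lemma abs_continuous_on_add:
  assumes "abs_continuous_on S g" "abs_continuous_on S h"
  shows "abs_continuous_on S (\<lambda>t. g t + h t)"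
proof (rule abs_continuous_onI)
  fix e :: real assume "e > 0"
  then have "e / 2 > 0" by simp
  obtain d where "d > 0" and d: "\<And>I. nonoverlapping_in S I \<Longrightarrow>
      (\<Sum>(s, t)\<in>I. t - s) < d \<Longrightarrow> (\<Sum>(s, t)\<in>I. norm (g t - g s)) < e / 2"
    using abs_continuous_onE[OF assms(1) \<open>e / 2 > 0\<close>] by blast
  obtain d' where "d' > 0" and d': "\<And>I. nonoverlapping_in S I \<Longrightarrow>
      (\<Sum>(s, t)\<in>I. t - s) < d' \<Longrightarrow> (\<Sum>(s, t)\<in>I. norm (h t - h s)) < e / 2"
    using abs_continuous_onE[OF assms(2) \<open>e / 2 > 0\<close>] by blast
  have "(\<Sum>(s, t)\<in>I. norm (g t + h t - (g s + h s))) < e"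
    if I: "nonoverlapping_in S I" "(\<Sum>(s, t)\<in>I. t - s) < min d d'" for I
  proof -
    have "(\<Sum>(s, t)\<in>I. norm (g t + h t - (g s + h s)))
        \<le> (\<Sum>(s, t)\<in>I. norm (g t - g s) + norm (h t - h s))"
      by (intro sum_mono) (auto simp: add_diff_add norm_triangle_ineq)
    also have "\<dots> = (\<Sum>(s, t)\<in>I. norm (g t - g s)) + (\<Sum>(s, t)\<in>I. norm (h t - h s))"
      by (simp add: sum.distrib case_prod_unfold)
    also have "\<dots> < e"
      using d[OF I(1)] d'[OF I(1)] I(2) by simp
    finally show ?thesis .
  qed
  moreover have "min d d' > 0" using \<open>d > 0\<close> \<open>d' > 0\<close> by simp
  ultimately show "\<exists>d>0. \<forall>I. nonoverlapping_in S I \<longrightarrow>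
      (\<Sum>(s, t)\<in>I. t - s) < d \<longrightarrow> (\<Sum>(s, t)\<in>I. norm (g t + h t - (g s + h s))) < e"
    by blast
qed

lemma abs_continuous_on_imp_continuous_on:
  assumes "abs_continuous_on {a..b} h"
  shows "continuous_on {a..b} h"
  unfolding continuous_on_iff
proof (intro ballI allI impI)
  fix s e :: real assume s: "s \<in> {a..b}" and "e > 0"
  obtain d where "d > 0" and d: "\<And>I. nonoverlapping_in {a..b} I \<Longrightarrow>
      (\<Sum>(s, t)\<in>I. t - s) < d \<Longrightarrow> (\<Sum>(s, t)\<in>I. norm (h t - h s)) < e"
    using abs_continuous_onE[OF assms \<open>e > 0\<close>] by blast
  have "dist (h t) (h s) < e" if "t \<in> {a..b}" "dist t s < d" for t
    \<comment> \<open>A single interval is an admissible family; \<open>min\<close> and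
      \<open>max\<close> order its endpoints.\<close>
    using d[of "{(min s t, max s t)}"] s that
    by (cases "s \<le> t") (auto simp: nonoverlapping_in_def dist_norm norm_minus_commute)
  then show "\<exists>d>0. \<forall>t\<in>{a..b}. dist t s < d \<longrightarrow> dist (h t) (h s) < e"
    using \<open>d > 0\<close> by blast
qed

text \<open>Squaring is Lipschitz on bounded sets, and \<open>h\<close> is bounded on the compact
  interval by continuity.\<close>

lemma abs_continuous_on_norm_diff_power2:
  fixes h :: "real \<Rightarrow> 'a::real_inner"
  assumes "abs_continuous_on {a..b} h"
  shows "abs_continuous_on {a..b} (\<lambda>t. (norm (h t - c))\<^sup>2)"
proof -
  have "bounded ((\<lambda>t. h t - c) ` {a..b})"
    using abs_continuous_on_imp_continuous_on[OF assms]
    by (intro compact_imp_bounded compact_continuous_image continuous_intros) auto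
  then obtain M where M: "\<forall>t\<in>{a..b}. norm (h t - c) \<le> M"
    by (auto simp: bounded_iff)
  show ?thesis
  proof (rule abs_continuous_on_lipschitz_transfer[OF assms, of "2 * \<bar>M\<bar>"])
    fix s t assume "s \<in> {a..b}" "t \<in> {a..b}"
    then have M': "norm (h s - c) \<le> M" "norm (h t - c) \<le> M"
      using M by auto
    have "norm ((norm (h t - c))\<^sup>2 - (norm (h s - c))\<^sup>2)
        = (norm (h t - c) + norm (h s - c)) * \<bar>norm (h t - c) - norm (h s - c)\<bar>"
      by (simp add: power2_eq_square square_diff_square_factored abs_mult)
    also have "\<dots> \<le> (2 * \<bar>M\<bar>) * norm (h t - h s)"
      using M' norm_triangle_ineq3[of "h t - c" "h s - c"]
      by (intro mult_mono) auto
    finally show "norm ((norm (h t - c))\<^sup>2 - (norm (h s - c))\<^sup>2) \<le> 2 * \<bar>M\<bar> * norm (h t - h s)" .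
  qed auto
qed

section \<open>Increments bounded by the integral of a derivative bound\<close>

text \<open>
  A gauge argument replaces the a.e. differentiability of indefinite integrals: on a sufficiently
  fine tagged division the derivative bound controls the increments of \<open>h\<close> at tags outside \<open>N\<close>,
  while the intervals tagged in \<open>N\<close> lie in an open set of small measure, where absolute continuity
  applies.
\<close>

lemma abs_continuous_on_diff_le_integral:
  fixes h \<phi> :: "real \<Rightarrow> real"
  assumes "a \<le> b" and ac: "abs_continuous_on {a..b} h" and \<phi>: "\<phi> integrable_on {a..b}"
    and N: "negligible N"
    and der: "\<And>t. t \<in> {a..b} - N \<Longrightarrow>
      \<exists>D\<le>\<phi> t. (h has_real_derivative D) (at t within {a..b})"
  shows "h b - h a \<le> integral {a..b} \<phi>"
proof (rule field_le_epsilon)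
  fix e :: real assume "e > 0"
  \<comment> \<open>The error budget: one \<open>c\<close> for the Riemann sum, one for the
    intervals tagged in \<open>N\<close>, and \<open>c * (b - a)\<close> for the derivative
    estimates at the other tags.\<close>
  define c where "c = e / (2 + (b - a))"
  have "c > 0"
    using \<open>e > 0\<close> \<open>a \<le> b\<close> by (simp add: c_def)
  have "e = c * (2 + (b - a))"
    using \<open>a \<le> b\<close> by (simp add: c_def)
  then have e_eq: "e = c + c + c * (b - a)"
    by (simp add: algebra_simps)
  \<comment> \<open>Setting the integrand to 0 on \<open>N\<close> leaves the integral unchanged and
    removes the tags in \<open>N\<close> from the Riemann sum.\<close>
  define \<psi> where "\<psi> t = (if t \<in> N then 0 else \<phi> t)" for t
  have "(\<psi> has_integral integral {a..b} \<phi>) {a..b}"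
    using has_integral_spike[OF N _ integrable_integral[OF \<phi>], of \<psi>] by (auto simp: \<psi>_def)
  then obtain \<gamma> where "gauge \<gamma>" and \<gamma>: "\<And>p. p tagged_division_of {a..b} \<Longrightarrow> \<gamma> fine p \<Longrightarrow>
      norm ((\<Sum>(t, K)\<in>p. measure lborel K *\<^sub>R \<psi> t) - integral {a..b} \<phi>) < c"
    unfolding has_integral_real using \<open>c > 0\<close> by meson
  obtain d where "d > 0" and d: "\<And>I. nonoverlapping_in {a..b} I \<Longrightarrow>
      (\<Sum>(s, t)\<in>I. t - s) < d \<Longrightarrow> (\<Sum>(s, t)\<in>I. norm (h t - h s)) < c"
    using abs_continuous_onE[OF ac \<open>c > 0\<close>] by blast
  have N0: "N \<in> null_sets lebesgue"
    using N by (simp add: negligible_iff_null_sets)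
  \<comment> \<open>Outer regularity: \<open>U\<close> covers the null set \<open>N\<close> with
    measure below the modulus \<open>d\<close> of absolute continuity.\<close>
  obtain U where U: "open U" "N \<subseteq> U" and small: "emeasure lebesgue (U - N) < ennreal d"
    using sets_lebesgue_outer_open[OF null_setsD2[OF N0] \<open>d > 0\<close>] by metis
  have "emeasure lebesgue U < ennreal d"
    using small emeasure_Diff_null_set[OF N0, of U] U by simp
  moreover from this have U_meas: "U \<in> lmeasurable"
    using U by (auto simp: fmeasurable_def intro: less_trans)
  ultimately have U_small: "measure lebesgue U < d"
    using \<open>d > 0\<close> by (simp add: emeasure_eq_measure2 ennreal_less_iff)
  \<comment> \<open>A straddle estimate: since the tag \<open>t\<close> lies between
    \<open>u\<close> and \<open>v\<close>, the two first-order errors at \<open>t\<close> add up to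
    at most \<open>c * (v - u)\<close>.\<close>
  have "\<exists>r>0. t \<in> {a..b} - N \<longrightarrow> (\<forall>u v. u \<le> t \<longrightarrow> t \<le> v \<longrightarrow> {u..v} \<subseteq> {a..b} \<inter> ball t r \<longrightarrow>
      h v - h u \<le> (\<phi> t + c) * (v - u))" for t
  proof (cases "t \<in> {a..b} - N")
    case True
    then obtain D where "D \<le> \<phi> t" and D: "(h has_real_derivative D) (at t within {a..b})"
      using der by blast
    then obtain r where "r > 0" and r: "\<forall>s\<in>{a..b}. norm (s - t) < r \<longrightarrow>
        norm (h s - h t - D * (s - t)) \<le> c * norm (s - t)"
      using \<open>c > 0\<close> unfolding has_field_derivative_def has_derivative_within_alt by meson
    have "h v - h u \<le> (\<phi> t + c) * (v - u)"
      if uv: "u \<le> t" "t \<le> v" "{u..v} \<subseteq> {a..b} \<inter> ball t r" for u v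
    proof -
      have "u \<in> {u..v}" "v \<in> {u..v}"
        using uv(1,2) by auto
      then have "u \<in> {a..b} \<inter> ball t r" "v \<in> {a..b} \<inter> ball t r"
        using uv(3) by blast+
      then have "norm (h u - h t - D * (u - t)) \<le> c * norm (u - t)"
        "norm (h v - h t - D * (v - t)) \<le> c * norm (v - t)"
        using r by (auto simp: dist_norm norm_minus_commute)
      then have "h v - h u \<le> (D + c) * (v - u)"
        using uv(1,2) by (auto simp: algebra_simps)
      also have "\<dots> \<le> (\<phi> t + c) * (v - u)"
        using \<open>D \<le> \<phi> t\<close> uv(1,2) by (intro mult_right_mono) auto
      finally show ?thesis .
    qed
    then show ?thesis using \<open>r > 0\<close> by blast
  qed (auto intro: exI[of _ 1])
  then obtain r where r_pos: "\<And>t. r t > 0" and r: "\<And>t u v. t \<in> {a..b} - N \<Longrightarrow> u \<le> t \<Longrightarrow> t \<le> v \<Longrightarrow>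
      {u..v} \<subseteq> {a..b} \<inter> ball t (r t) \<Longrightarrow> h v - h u \<le> (\<phi> t + c) * (v - u)"
    by metis
  \<comment> \<open>At tags in \<open>N\<close> this gauge forces the interval into
    \<open>U\<close>; elsewhere it enforces the radius of the straddle estimate.\<close>
  define \<gamma>' where "\<gamma>' t = (if t \<in> N then U else ball t (r t))" for t
  have "gauge \<gamma>'"
    using U r_pos by (auto simp: gauge_def \<gamma>'_def)
  with \<open>gauge \<gamma>\<close> obtain p where p: "p tagged_division_of {a..b}" and fine: "\<gamma> fine p" "\<gamma>' fine p"
    using fine_division_exists_real[OF gauge_Int] unfolding fine_Int by metis
  have elem: "t \<in> K" "K \<subseteq> \<gamma>' t" "K \<subseteq> {a..b}" "K = {Inf K..Sup K}" "Inf K \<le> Sup K"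
    if "(t, K) \<in> p" for t K
  proof -
    show *: "t \<in> K" "K \<subseteq> \<gamma>' t" "K \<subseteq> {a..b}"
      using p fine(2) that by (auto simp: fine_def)
    obtain u v where "K = {u..v}"
      using tagged_division_ofD(4)[OF p \<open>(t, K) \<in> p\<close>] by auto
    then show "K = {Inf K..Sup K}" "Inf K \<le> Sup K"
      using *(1) by auto
  qed
  define q where "q = {(t, K) \<in> p. t \<in> N}"
  have "finite p" "q \<subseteq> p" using p by (auto simp: q_def)
  then have "finite q" using finite_subset by blast
  have q: "q tagged_division_of \<Union>(snd ` q)"
    using p \<open>q \<subseteq> p\<close> unfolding tagged_division_of_def[of p]
    by (blast intro!: tagged_partial_division_of_Union_self intro: tagged_partial_division_subset)
  define \<D> where "\<D> = snd ` q"
  have \<D>: "\<D> division_of \<Union>\<D>"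
    using q unfolding \<D>_def by (rule division_of_tagged_division)
  have \<D>_elem: "K = {Inf K..Sup K}" "Inf K \<le> Sup K" "K \<subseteq> {a..b}" "K \<subseteq> U" if "K \<in> \<D>" for K
  proof -
    obtain t where "(t, K) \<in> p" "t \<in> N"
      using \<open>K \<in> \<D>\<close> by (auto simp: \<D>_def q_def)
    then show "K = {Inf K..Sup K}" "Inf K \<le> Sup K" "K \<subseteq> {a..b}" "K \<subseteq> U"
      using elem[of t K] by (simp_all add: \<gamma>'_def)
  qed
  \<comment> \<open>Absolute continuity speaks of endpoint pairs; a nonempty closed interval is
    determined by its endpoints, so sums over \<D> and over \<open>I\<close> agree.\<close>
  have inj: "inj_on (\<lambda>K. (Inf K, Sup K)) \<D>"
    by (intro inj_onI) (metis \<D>_elem(1) prod.inject)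
  define I where "I = (\<lambda>K. (Inf K, Sup K)) ` \<D>"
  have "nonoverlapping_in {a..b} I"
    unfolding nonoverlapping_in_def
  proof (intro conjI)
    show "finite I"
      using \<open>finite q\<close> by (simp add: I_def \<D>_def)
    have "Inf K \<le> Sup K \<and> {Inf K..Sup K} \<subseteq> {a..b}" if "K \<in> \<D>" for K
      using \<D>_elem(1-3)[OF that] by simp
    then show "\<forall>(s, t)\<in>I. s \<le> t \<and> {s..t} \<subseteq> {a..b}"
      unfolding I_def by blast
    have "disjnt {Inf K<..<Sup K} {Inf K'<..<Sup K'}" if "K \<in> \<D>" "K' \<in> \<D>" "K \<noteq> K'" for K K'
    proof -
      have "interior {Inf K..Sup K} \<inter> interior {Inf K'..Sup K'} = {}"
        using division_ofD(5)[OF \<D> that]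
        by (simp flip: \<D>_elem(1)[OF that(1)] \<D>_elem(1)[OF that(2)])
      then show ?thesis
        by (simp add: disjnt_def interior_atLeastAtMost_real)
    qed
    then show "pairwise (\<lambda>(s, t) (s', t'). disjnt {s<..<t} {s'<..<t'}) I"
      unfolding I_def pairwise_image by (auto simp: pairwise_def)
  qed
  \<comment> \<open>The intervals do not overlap, so their total length is the measure of their
    union, which lies inside \<open>U\<close>.\<close>
  moreover have "(\<Sum>(s, t)\<in>I. t - s) < d"
  proof -
    have "(\<Sum>(s, t)\<in>I. t - s) = (\<Sum>K\<in>\<D>. Sup K - Inf K)"
      unfolding I_def by (simp add: sum.reindex[OF inj])
    also have "\<dots> = (\<Sum>K\<in>\<D>. measure lebesgue K)"
    proof (rule sum.cong[OF refl])
      fix K assume "K \<in> \<D>"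
      have "measure lebesgue {Inf K..Sup K} = Sup K - Inf K"
        using \<D>_elem(2)[OF \<open>K \<in> \<D>\<close>] by (simp add: content_real)
      then show "Sup K - Inf K = measure lebesgue K"
        by (simp flip: \<D>_elem(1)[OF \<open>K \<in> \<D>\<close>])
    qed
    also have "\<dots> = measure lebesgue (\<Union>\<D>)"
      by (rule content_division[OF \<D>])
    also have "\<dots> \<le> measure lebesgue U"
      using \<D>_elem(4) lmeasurable_division[OF \<D>] U_meas
      by (intro measure_mono_fmeasurable Union_least fmeasurableD)
    finally show ?thesis using U_small by simp
  qed
  ultimately have "(\<Sum>(s, t)\<in>I. norm (h t - h s)) < c"
    by (rule d)
  also have "(\<Sum>(s, t)\<in>I. norm (h t - h s)) = (\<Sum>K\<in>\<D>. norm (h (Sup K) - h (Inf K)))"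
    unfolding I_def by (simp add: sum.reindex[OF inj])
  \<comment> \<open>Passing from \<D> to the tagged pairs in \<open>q\<close> needs a summand that
    vanishes on every interval with empty interior. Singletons give 0 anyway; for the empty set,
    whose \<open>Sup\<close> and \<open>Inf\<close> carry no information, the value 0 is put in by
    hand.\<close>
  also have "\<dots> = (\<Sum>K\<in>\<D>. if K = {} then 0 else norm (h (Sup K) - h (Inf K)))"
    using division_ofD(3)[OF \<D>] by (intro sum.cong) auto
  also have "\<dots> = (\<Sum>(t, K)\<in>q. if K = {} then 0 else norm (h (Sup K) - h (Inf K)))"
    unfolding \<D>_def
    by (rule sum.over_tagged_division_lemma[OF q, symmetric]) (auto simp: box_eq_empty)
  also have "\<dots> = (\<Sum>(t, K)\<in>q. norm (h (Sup K) - h (Inf K)))"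
    using elem(1) \<open>q \<subseteq> p\<close> by (intro sum.cong) fastforce+
  finally have bad: "(\<Sum>(t, K)\<in>q. norm (h (Sup K) - h (Inf K))) < c" .
  have "h b - h a = (\<Sum>(t, K)\<in>p. h (Sup K) - h (Inf K))"
    using additive_tagged_division_1[OF \<open>a \<le> b\<close> p, of h] by simp
  \<comment> \<open>Every tag gets the same three-term bound: at a tag in \<open>N\<close> the
    Riemann term is 0 and the increment itself is kept; elsewhere the straddle estimate
    applies.\<close>
  also have "\<dots> \<le> (\<Sum>(t, K)\<in>p. measure lborel K *\<^sub>R \<psi> t + c * measure lborel K +
      (if t \<in> N then norm (h (Sup K) - h (Inf K)) else 0))"
  proof (intro sum_mono, clarify)
    fix t K assume tK: "(t, K) \<in> p"
    have "measure lborel {Inf K..Sup K} = Sup K - Inf K"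
      using elem(5)[OF tK] by (rule content_real)
    then have content: "measure lborel K = Sup K - Inf K"
      by (simp flip: elem(4)[OF tK])
    show "h (Sup K) - h (Inf K) \<le> measure lborel K *\<^sub>R \<psi> t + c * measure lborel K +
        (if t \<in> N then norm (h (Sup K) - h (Inf K)) else 0)"
    proof (cases "t \<in> N")
      case True
      then show ?thesis
        using \<open>c > 0\<close> by (simp add: \<psi>_def add_increasing)
    next
      case False
      have "h (Sup K) - h (Inf K) \<le> (\<phi> t + c) * (Sup K - Inf K)"
      proof (rule r)
        show "t \<in> {a..b} - N" using elem(1,3)[OF tK] False by blast
        have "t \<in> {Inf K..Sup K}" by (simp only: elem(1)[OF tK] flip: elem(4)[OF tK])
        then show "Inf K \<le> t" "t \<le> Sup K" by auto
        show "{Inf K..Sup K} \<subseteq> {a..b} \<inter> ball t (r t)"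
          using elem(2,3)[OF tK] False by (simp add: \<gamma>'_def flip: elem(4)[OF tK])
      qed
      then show ?thesis
        using False by (simp add: \<psi>_def content algebra_simps)
    qed
  qed
  also have "\<dots> = (\<Sum>(t, K)\<in>p. measure lborel K *\<^sub>R \<psi> t) + c * (\<Sum>(t, K)\<in>p. measure lborel K) +
      (\<Sum>(t, K)\<in>p. if t \<in> N then norm (h (Sup K) - h (Inf K)) else 0)"
    by (simp add: sum.distrib sum_distrib_left case_prod_unfold)
  also have "(\<Sum>(t, K)\<in>p. measure lborel K) = b - a"
    using additive_content_tagged_division[of p a b] p \<open>a \<le> b\<close> by (simp add: content_real)
  also have "(\<Sum>(t, K)\<in>p. if t \<in> N then norm (h (Sup K) - h (Inf K)) else 0)
      = (\<Sum>(t, K)\<in>q. norm (h (Sup K) - h (Inf K)))"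
    using \<open>finite p\<close> unfolding q_def by (intro sum.mono_neutral_cong_right) (auto split: if_splits)
  also have "(\<Sum>(t, K)\<in>p. measure lborel K *\<^sub>R \<psi> t) + c * (b - a) +
      (\<Sum>(t, K)\<in>q. norm (h (Sup K) - h (Inf K))) \<le> integral {a..b} \<phi> + e"
    using bad \<gamma>[OF p fine(1)] e_eq by (simp add: abs_less_iff)
  finally show "h b - h a \<le> integral {a..b} \<phi> + e" .
qed

section \<open>Decrease of the energy along solutions\<close>

lemma has_real_derivative_norm_diff_power2:
  fixes h :: "real \<Rightarrow> 'a::real_inner"
  assumes "(h has_vector_derivative h') (at t within S)"
  shows "((\<lambda>t. (norm (h t - c))\<^sup>2) has_real_derivative 2 * ((h t - c) \<bullet> h')) (at t within S)"
  using assms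
  unfolding power2_norm_eq_inner has_field_derivative_def has_vector_derivative_def
  by (auto intro!: derivative_eq_intros simp: inner_commute algebra_simps fun_eq_iff)

lemma closed_nonneg_orthant: "closed (nonneg_orthant :: (real ^ 'm) set)"
  and convex_nonneg_orthant: "convex (nonneg_orthant :: (real ^ 'm) set)"
proof -
  have eq: "(nonneg_orthant :: (real ^ 'm) set) = (\<Inter>i. {l. 0 \<le> l $ i})"
    by (auto simp: nonneg_orthant_def less_eq_vec_def)
  show "closed (nonneg_orthant :: (real ^ 'm) set)"
    unfolding eq by (intro closed_INT ballI closed_Collect_le continuous_intros)
  show "convex (nonneg_orthant :: (real ^ 'm) set)"
    unfolding eq by (intro convex_INT) (auto simp: convex_def)
qed

text \<open>The left-hand side is the time derivative of the energy at the state
  \<open>(y, l)\<close>. Removing both projections can only increase it; the subgradient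
  inequalities at \<open>z\<close>, weighted by the nonnegative multipliers \<open>l\<close>, then
  make everything but \<open>- \<epsilon> * g y $ i\<close> nonpositive.\<close>

lemma saddle_point_energy_decrease:
  fixes A :: "real ^ 'm ^ 'n" and g :: "real ^ 'n \<Rightarrow> real ^ 'm"
  assumes "closed X" "convex X" "y \<in> X" "l \<in> nonneg_orthant" "\<epsilon> \<ge> 0"
    and sub: "\<And>j. is_subgradient X (\<lambda>z. g z $ j) y (column j A)"
    and "z \<in> X" "g z \<le> 0"
  shows "(y - z) \<bullet> proj_dir X y (- (\<epsilon> *\<^sub>R (A *v l)))
      + (l - axis i 1) \<bullet> proj_dir nonneg_orthant l (\<epsilon> *\<^sub>R g y) \<le> - \<epsilon> * g y $ i"
proof -
  have "l $ j * (g y $ j + (z - y) \<bullet> column j A) \<le> 0" for j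
  proof -
    have "g y $ j + (z - y) \<bullet> column j A \<le> g z $ j"
      using sub \<open>z \<in> X\<close> by (auto simp: is_subgradient_def inner_commute)
    also have "\<dots> \<le> 0"
      using \<open>g z \<le> 0\<close> by (simp add: less_eq_vec_def)
    finally show ?thesis
      using \<open>l \<in> nonneg_orthant\<close> by (simp add: nonneg_orthant_def less_eq_vec_def mult_nonneg_nonpos)
  qed
  then have "(\<Sum>j\<in>UNIV. l $ j * (g y $ j + (z - y) \<bullet> column j A)) \<le> 0"
    by (intro sum_nonpos)
  also have "(\<Sum>j\<in>UNIV. l $ j * (g y $ j + (z - y) \<bullet> column j A)) = l \<bullet> g y + (z - y) \<bullet> (A *v l)"
    by (simp add: matrix_mult_sum inner_vec_def[of l] inner_sum_right scalar_mult_eq_scaleR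
        distrib_left sum.distrib)
  finally have *: "l \<bullet> g y + (z - y) \<bullet> (A *v l) \<le> 0" .
  \<comment> \<open>The unit vector is an admissible comparison point for the dual projection; its
    share of the inner product singles out component \<open>i\<close>.\<close>
  have "axis i (1::real) \<in> nonneg_orthant"
    by (simp add: nonneg_orthant_def less_eq_vec_def axis_def)
  then have "(l - axis i 1) \<bullet> proj_dir nonneg_orthant l (\<epsilon> *\<^sub>R g y) \<le> (l - axis i 1) \<bullet> (\<epsilon> *\<^sub>R g y)"
    using assms by (intro proj_dir_inner_le closed_nonneg_orthant convex_nonneg_orthant)
  moreover have "(y - z) \<bullet> proj_dir X y (- (\<epsilon> *\<^sub>R (A *v l))) \<le> (y - z) \<bullet> (- (\<epsilon> *\<^sub>R (A *v l)))"
    using assms by (intro proj_dir_inner_le)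
  moreover have "(y - z) \<bullet> (- (\<epsilon> *\<^sub>R (A *v l))) + (l - axis i 1) \<bullet> (\<epsilon> *\<^sub>R g y)
      = \<epsilon> * (l \<bullet> g y + (z - y) \<bullet> (A *v l)) - \<epsilon> * g y $ i"
    by (simp add: inner_simps inner_axis' algebra_simps)
  moreover have "\<epsilon> * (l \<bullet> g y + (z - y) \<bullet> (A *v l)) \<le> 0"
    using * \<open>\<epsilon> \<ge> 0\<close> by (rule mult_nonneg_nonpos[rotated])
  ultimately show ?thesis by linarith
qed

lemma saddle_point_fit_le_energy:
  fixes X :: "(real ^ 'n) set" and g :: "real \<Rightarrow> real ^ 'n \<Rightarrow> real ^ 'm"
  assumes "closed X" "convex X" "\<epsilon> > 0" "T > 0"
    and sub: "\<And>t i y. y \<in> X \<Longrightarrow> is_subgradient X (\<lambda>z. g t z $ i) y (column i (G t y))"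
    and sol: "saddle_point_solution X \<epsilon> g G x l"
    and int: "(\<lambda>t. g t (x t)) absolutely_integrable_on {0..T}"
    and z: "z \<in> feasible_upto X g T"
  shows "fit g x T $ i \<le> 1 / \<epsilon> * energy z (axis i 1) (x 0) (l 0)"
proof -
  define V where "V t = energy z (axis i 1) (x t) (l t)" for t
  have in_X: "x t \<in> X" and in_orthant: "l t \<in> nonneg_orthant" if "t \<ge> 0" for t
    using sol that by (auto simp: saddle_point_solution_def)
  have "abs_continuous_on {0..T} (\<lambda>t. (norm (x t - z))\<^sup>2 + (norm (l t - axis i 1))\<^sup>2)"
    using sol \<open>T > 0\<close> unfolding saddle_point_solution_def
    by (intro abs_continuous_on_add abs_continuous_on_norm_diff_power2) auto
  \<comment> \<open>The factor 1/2 in the energy only shrinks increments, so the Lipschitz constant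
    1 suffices.\<close>
  then have V_ac: "abs_continuous_on {0..T} V"
    by (rule abs_continuous_on_lipschitz_transfer[where L = 1])
      (auto simp: V_def energy_def simp flip: diff_divide_distrib)
  obtain N where N: "negligible N" and der: "\<And>t. t \<notin> N \<Longrightarrow> t \<ge> 0 \<Longrightarrow>
      (x has_vector_derivative proj_dir X (x t) (- (\<epsilon> *\<^sub>R (G t (x t) *v l t)))) (at t within {0..}) \<and>
      (l has_vector_derivative proj_dir nonneg_orthant (l t) (\<epsilon> *\<^sub>R g t (x t))) (at t within {0..})"
    using sol unfolding saddle_point_solution_def eventually_ae_filter_negligible by blast
  \<comment> \<open>Taking a coordinate is bounded linear and commutes with the integral; absolute
    integrability identifies the Lebesgue integral in \<open>fit\<close> with the gauge
    integral.\<close>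
  have int_i: "(\<lambda>t. g t (x t) $ i) integrable_on {0..T}"
    and integral_i: "integral {0..T} (\<lambda>t. g t (x t) $ i) = fit g x T $ i"
    using integrable_linear[OF _ bounded_linear_vec_nth[of i]]
      integral_linear[OF _ bounded_linear_vec_nth[of i]] set_lebesgue_integral_eq_integral[OF int]
    by (auto simp: o_def fit_def)
  have "V T - V 0 \<le> integral {0..T} (\<lambda>t. - \<epsilon> * g t (x t) $ i)"
  proof (rule abs_continuous_on_diff_le_integral[OF _ V_ac _ N])
    show "0 \<le> T" using \<open>T > 0\<close> by simp
    show "(\<lambda>t. - \<epsilon> * g t (x t) $ i) integrable_on {0..T}"
      using int_i by (intro integrable_on_mult_right)
    fix t assume t: "t \<in> {0..T} - N"
    let ?x' = "proj_dir X (x t) (- (\<epsilon> *\<^sub>R (G t (x t) *v l t)))"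
    let ?l' = "proj_dir nonneg_orthant (l t) (\<epsilon> *\<^sub>R g t (x t))"
    let ?D = "(x t - z) \<bullet> ?x' + (l t - axis i 1) \<bullet> ?l'"
    have x': "(x has_vector_derivative ?x') (at t within {0..T})"
      and l': "(l has_vector_derivative ?l') (at t within {0..T})"
      using der[of t] t by (auto elim: has_vector_derivative_within_subset)
    have "(V has_real_derivative ?D) (at t within {0..T})"
      unfolding V_def energy_def
      by (rule derivative_eq_intros has_real_derivative_norm_diff_power2 x' l' refl)+ simp
    moreover have "?D \<le> - \<epsilon> * g t (x t) $ i"
      using t z assms(1-3) in_X in_orthant
      by (intro saddle_point_energy_decrease sub) (auto simp: feasible_upto_def)
    ultimately show "\<exists>D\<le>- \<epsilon> * g t (x t) $ i. (V has_real_derivative D) (at t within {0..T})"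
      by blast
  qed
  also have "\<dots> = - \<epsilon> * fit g x T $ i"
    by (simp flip: integral_i)
  finally have "V T - V 0 \<le> - \<epsilon> * fit g x T $ i" .
  moreover have "V T \<ge> 0"
    by (simp add: V_def energy_def)
  ultimately have "\<epsilon> * fit g x T $ i \<le> V 0"
    by simp
  then show ?thesis
    using \<open>\<epsilon> > 0\<close> by (simp add: V_def field_simps)
qed

section \<open>Closedness of the feasible set\<close>

text \<open>A subgradient at the limit point \<open>y\<close> gives an affine minorant that is at
  most \<open>c\<close> along the sequence; its value at \<open>y\<close> is \<open>g y\<close>, so
  the bound passes to the limit. This includes boundary points of \<open>X\<close>, where convexity
  alone does not give lower semicontinuity.\<close>

lemma closed_sublevel_if_subgradients:
  fixes X :: "'a::euclidean_space set"
  assumes "closed X" and sub: "\<And>y. y \<in> X \<Longrightarrow> \<exists>s. is_subgradient X g y s"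
  shows "closed {y \<in> X. g y \<le> c}"
  unfolding closed_sequential_limits
proof (intro allI impI, elim conjE)
  fix u y assume u: "\<forall>n. u n \<in> {y \<in> X. g y \<le> c}" and lim: "u \<longlonglongrightarrow> y"
  then have "y \<in> X"
    using \<open>closed X\<close> closed_sequentially by blast
  then obtain s where s: "is_subgradient X g y s"
    using sub by blast
  have "(\<lambda>n. g y + s \<bullet> (u n - y)) \<longlonglongrightarrow> g y + s \<bullet> (y - y)"
    by (intro tendsto_intros lim)
  moreover have "g y + s \<bullet> (u n - y) \<le> c" for n
    using s u by (force simp: is_subgradient_def intro: order_trans)
  ultimately have "g y + s \<bullet> (y - y) \<le> c"
    by (intro LIMSEQ_le_const2) auto
  then show "y \<in> {y \<in> X. g y \<le> c}"
    using \<open>y \<in> X\<close> by simp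
qed

lemma closed_feasible_upto:
  assumes "closed X" and "\<And>t i y. y \<in> X \<Longrightarrow> \<exists>s. is_subgradient X (\<lambda>z. f t z $ i) y s"
  shows "closed (feasible_upto X f T)"
proof -
  have "feasible_upto X f T = X \<inter> (\<Inter>t\<in>{0..T}. \<Inter>i. {y \<in> X. f t y $ i \<le> 0})"
    by (auto simp: feasible_upto_def less_eq_vec_def)
  also have "closed \<dots>"
    using assms by (intro closed_Int closed_INT ballI closed_sublevel_if_subgradients)
  finally show ?thesis .
qed

section \<open>The uniform bound and the attained minimum\<close>

theorem corollary2:
  fixes X :: "(real ^ 'n) set"
    and f :: "real \<Rightarrow> real ^ 'n \<Rightarrow> real ^ 'm"
    and G :: "real \<Rightarrow> real ^ 'n \<Rightarrow> real ^ 'm ^ 'n"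
    and x :: "real \<Rightarrow> real ^ 'n"
    and l :: "real \<Rightarrow> real ^ 'm"
    and \<delta> \<epsilon> :: real
  assumes "closed X" and "convex X"
    and f_integrable: "\<And>T y. T > 0 \<Longrightarrow> y \<in> X \<Longrightarrow> (\<lambda>t. f t y) absolutely_integrable_on {0..T}"
    and f_convex: "\<And>t i. convex_on X (\<lambda>y. f t y $ i)"
    and f_subgradients: "\<And>t i y. y \<in> X \<Longrightarrow> \<exists>s. is_subgradient X (\<lambda>z. f t z $ i) y s"
    and "viable X f"
    and "\<delta> > 0" and "\<epsilon> > 0"
    and G_subgradients:
      "\<And>t i y. y \<in> X \<Longrightarrow> is_subgradient X (\<lambda>z. saturated \<delta> f t z $ i) y (column i (G t y))"
    and solution: "saddle_point_solution X \<epsilon> (saturated \<delta> f) G x l"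
    and fit_well_defined:
      "\<And>T. T > 0 \<Longrightarrow> (\<lambda>t. saturated \<delta> f t (x t)) absolutely_integrable_on {0..T}"
  shows "(\<exists>C::real. \<forall>T>0. \<forall>i. fit (saturated \<delta> f) x T $ i \<le> C) \<and>
    (\<forall>T>0. \<forall>i. \<exists>xmin.
       is_arg_min (\<lambda>xd. 1 / \<epsilon> * energy xd (axis i 1) (x 0) (l 0))
         (\<lambda>xd. xd \<in> feasible_upto X f T) xmin \<and>
       fit (saturated \<delta> f) x T $ i \<le> 1 / \<epsilon> * energy xmin (axis i 1) (x 0) (l 0))"
proof -
  \<comment> \<open>A viable point is feasible on every horizon, so it can be chosen before
    \<open>T\<close>.\<close>
  obtain xd where xd: "\<And>T. xd \<in> feasible_upto X f T"
    using \<open>viable X f\<close> unfolding viable_def feasible_upto_def by force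
  have bound: "fit (saturated \<delta> f) x T $ i \<le> 1 / \<epsilon> * energy z (axis i 1) (x 0) (l 0)"
    if "T > 0" "z \<in> feasible_upto X f T" for T i z
  proof (rule saddle_point_fit_le_energy)
    \<comment> \<open>Saturation preserves feasibility: \<open>- \<delta>\<close> is negative, so
      the maximum is still nonpositive.\<close>
    show "z \<in> feasible_upto X (saturated \<delta> f) T"
      using that \<open>\<delta> > 0\<close> by (auto simp: feasible_upto_def saturated_def less_eq_vec_def)
  qed (use assms that in auto)
  \<comment> \<open>The comparison point \<open>xd\<close> does not depend on \<open>T\<close>; the
    maximum over the finitely many components gives one constant.\<close>
  define B where "B i = 1 / \<epsilon> * energy xd (axis i 1) (x 0) (l 0)" for i
  have "fit (saturated \<delta> f) x T $ i \<le> Max (range B)" if "T > 0" for T i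
  proof -
    have "fit (saturated \<delta> f) x T $ i \<le> B i"
      unfolding B_def using that xd by (rule bound)
    also have "\<dots> \<le> Max (range B)"
      by (intro Max_ge) auto
    finally show ?thesis .
  qed
  moreover have "\<exists>xmin. is_arg_min (\<lambda>xd. 1 / \<epsilon> * energy xd (axis i 1) (x 0) (l 0))
        (\<lambda>xd. xd \<in> feasible_upto X f T) xmin \<and>
       fit (saturated \<delta> f) x T $ i \<le> 1 / \<epsilon> * energy xmin (axis i 1) (x 0) (l 0)"
    if "T > 0" for T i
  proof -
    \<comment> \<open>Only the distance from \<open>x 0\<close> varies in the energy, so a point of
      the closed feasible set nearest to \<open>x 0\<close> is a minimizer.\<close>
    have "feasible_upto X f T \<noteq> {}"
      using xd by blast
    with closed_feasible_upto[OF \<open>closed X\<close> f_subgradients]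
    obtain w where w: "w \<in> feasible_upto X f T"
      and min: "\<And>y. y \<in> feasible_upto X f T \<Longrightarrow> dist (x 0) w \<le> dist (x 0) y"
      by (rule distance_attains_inf[where a = "x 0"]) auto
    have "1 / \<epsilon> * energy w (axis i 1) (x 0) (l 0) \<le> 1 / \<epsilon> * energy y (axis i 1) (x 0) (l 0)"
      if "y \<in> feasible_upto X f T" for y
      using min[OF that] \<open>\<epsilon> > 0\<close>
      by (intro mult_left_mono) (auto simp: energy_def dist_norm power_mono)
    then have "is_arg_min (\<lambda>xd. 1 / \<epsilon> * energy xd (axis i 1) (x 0) (l 0))
        (\<lambda>xd. xd \<in> feasible_upto X f T) w"
      using w by (simp add: is_arg_min_linorder)
    then show ?thesis
      using bound[OF \<open>T > 0\<close> w] by blast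
  qed
  ultimately show ?thesis by blast
qed

end
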